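(* Let $(L,(\cdot,\cdot),\Phi)$ be a p.n. root lattice with Weyl group $W$ and let $w\in W$. Define $$k_4(L,w):=\min\{k_2(L,L_1)\mid \text{a reduced presentation of } w \text{ with subroot lattice } L_1 \text{ exists}\},$$ $$k_5(L,w):=\min\{k \mid \text{a presentation } (\alpha_1,\dots,\alpha_{l(w)+2k}) \text{ of } w \text{ whose subroot lattice is the full lattice } L \text{ exists}\}.$$ Then $k_5(L,w)=k_4(L,w)$.
   Context: A lattice is a free $\mathbb{Z}$-module $L$ of finite rank; $L_{\mathbb{R}}=L\otimes\mathbb{R}$. A p.n. ("possibly nonreduced") root lattice is a triple $(L,(\cdot,\cdot),\Phi)$ where $L$ is a lattice, $(\cdot,\cdot)$ is a scalar product on $L_{\mathbb{R}}$, and $\Phi\subset L\setminus\{0\}$ is a finite set of "roots" such that: $\Phi$ generates $L$ as a $\mathbb{Z}$-module; for all $\alpha\in\Phi$ the reflection $s_\alpha(x)=x-\langle x,\alpha\rangle\alpha$ satisfies $s_\alpha(\Phi)=\Phi$; and $\langle\beta,\alpha\rangle:=2(\beta,\alpha)/(\alpha,\alpha)\in\mathbb{Z}$ for all $\alpha,\beta\in\Phi$. The Weyl group is $W=\langle s_\alpha\mid\alpha\in\Phi\rangle\subset O(L,(\cdot,\cdot))$. A presentation of $w\in W$ is a tuple $(\alpha_1,\dots,\alpha_k)\in\Phi^k$, $k\ge 0$, with $w=s_{\alpha_1}\circ\cdots\circ s_{\alpha_k}$ (arbitrary roots are allowed); $k$ is its length. The length $l(w)$ is the minimum of the lengths of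 all presentations of $w$, and a presentation is reduced if its length is $l(w)$. The subroot lattice of a presentation is $L_1:=\sum_{i=1}^k\mathbb{Z}\alpha_i\subset L$ (the zero lattice if $k=0$). For such a sublattice $L_1\subset L$, $k_2(L,L_1):=\min\{k\mid \exists\,\beta_1,\dots,\beta_k\in\Phi \text{ with } L=L_1+\sum_{j=1}^k\mathbb{Z}\beta_j\}$. *)

theory Defs
  imports
    Complex_Main
    "HOL-Algebra.Bij"
    "HOL-Algebra.Generated_Groups"
    "HOL-Computational_Algebra.Group_Closure"
    "HOL-Library.Set_Algebras"
begin

text \<open>
  A lattice is modelled inside a real vector space as the integer span of a finite \<open>\<real>\<close>-linearly
  independent set. Then \<open>span L\<close> is a copy of \<open>L \<otimes> \<real>\<close>, and every free \<open>\<int>\<close>-module of finite rank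
  (rank zero included) arises in this way. The \<open>\<int>\<close>-submodule generated by a set is its
  \<^const>\<open>group_closure\<close>.
\<close>

definition is_lattice :: "'a::real_vector set \<Rightarrow> bool" where
  "is_lattice L \<longleftrightarrow> (\<exists>B. finite B \<and> independent B \<and> L = group_closure B)"

text \<open>The scalar product is a function on the whole type, but nothing is required of it
  outside \<open>V\<close>.\<close>

definition scalar_product_on :: "'a::real_vector set \<Rightarrow> ('a \<Rightarrow> 'a \<Rightarrow> real) \<Rightarrow> bool" where
  "scalar_product_on V ip \<longleftrightarrow>
    (\<forall>x\<in>V. \<forall>y\<in>V. ip x y = ip y x) \<and>
    (\<forall>x\<in>V. \<forall>y\<in>V. \<forall>z\<in>V. ip (x + y) z = ip x z + ip y z) \<and>
    (\<forall>c. \<forall>x\<in>V. \<forall>y\<in>V. ip (c *\<^sub>R x) y = c * ip x y) \<and>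
    (\<forall>x\<in>V. x \<noteq> 0 \<longrightarrow> ip x x > 0)"

definition root_pairing :: "('a \<Rightarrow> 'a \<Rightarrow> real) \<Rightarrow> 'a \<Rightarrow> 'a \<Rightarrow> real" where
  "root_pairing ip \<beta> \<alpha> = 2 * ip \<beta> \<alpha> / ip \<alpha> \<alpha>"

text \<open>Automorphisms of \<open>L\<close> are extensional functions on \<open>L\<close>, as in \<^const>\<open>BijGroup\<close>, so
  that equality of functions means equality on \<open>L\<close>.\<close>

definition reflection :: "'a::real_vector set \<Rightarrow> ('a \<Rightarrow> 'a \<Rightarrow> real) \<Rightarrow> 'a \<Rightarrow> 'a \<Rightarrow> 'a" where
  "reflection L ip \<alpha> = (\<lambda>x\<in>L. x - root_pairing ip x \<alpha> *\<^sub>R \<alpha>)"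

definition pn_root_lattice ::
    "'a::real_vector set \<Rightarrow> ('a \<Rightarrow> 'a \<Rightarrow> real) \<Rightarrow> 'a set \<Rightarrow> bool" where
  "pn_root_lattice L ip \<Phi> \<longleftrightarrow>
    is_lattice L \<and> scalar_product_on (span L) ip \<and>
    finite \<Phi> \<and> \<Phi> \<subseteq> L - {0} \<and> group_closure \<Phi> = L \<and>
    (\<forall>\<alpha>\<in>\<Phi>. reflection L ip \<alpha> ` \<Phi> = \<Phi>) \<and>
    (\<forall>\<alpha>\<in>\<Phi>. \<forall>\<beta>\<in>\<Phi>. root_pairing ip \<beta> \<alpha> \<in> \<int>)"

definition orthogonal_group ::
    "'a::real_vector set \<Rightarrow> ('a \<Rightarrow> 'a \<Rightarrow> real) \<Rightarrow> ('a \<Rightarrow> 'a) monoid" where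
  "orthogonal_group L ip = BijGroup L
    \<lparr>carrier := {f \<in> Bij L. (\<forall>x\<in>L. \<forall>y\<in>L. f (x + y) = f x + f y \<and> ip (f x) (f y) = ip x y)}\<rparr>"

definition weyl_group ::
    "'a::real_vector set \<Rightarrow> ('a \<Rightarrow> 'a \<Rightarrow> real) \<Rightarrow> 'a set \<Rightarrow> ('a \<Rightarrow> 'a) set" where
  "weyl_group L ip \<Phi> = generate (orthogonal_group L ip) (reflection L ip ` \<Phi>)"

definition presentation ::
    "'a::real_vector set \<Rightarrow> ('a \<Rightarrow> 'a \<Rightarrow> real) \<Rightarrow> 'a set \<Rightarrow> ('a \<Rightarrow> 'a) \<Rightarrow> 'a list \<Rightarrow> bool" where
  "presentation L ip \<Phi> w \<alpha>s \<longleftrightarrow>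
    set \<alpha>s \<subseteq> \<Phi> \<and> w = foldr (compose L) (map (reflection L ip) \<alpha>s) (\<lambda>x\<in>L. x)"

text \<open>All minima below are over nonempty sets of natural numbers when \<open>(L, ip, \<Phi>)\<close> is a
  p.n. root lattice and \<open>w\<close> lies in its Weyl group.\<close>

definition weyl_length ::
    "'a::real_vector set \<Rightarrow> ('a \<Rightarrow> 'a \<Rightarrow> real) \<Rightarrow> 'a set \<Rightarrow> ('a \<Rightarrow> 'a) \<Rightarrow> nat" where
  "weyl_length L ip \<Phi> w = (LEAST k. \<exists>\<alpha>s. presentation L ip \<Phi> w \<alpha>s \<and> length \<alpha>s = k)"

definition reduced_presentation ::
    "'a::real_vector set \<Rightarrow> ('a \<Rightarrow> 'a \<Rightarrow> real) \<Rightarrow> 'a set \<Rightarrow> ('a \<Rightarrow> 'a) \<Rightarrow> 'a list \<Rightarrow> bool" where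
  "reduced_presentation L ip \<Phi> w \<alpha>s \<longleftrightarrow>
    presentation L ip \<Phi> w \<alpha>s \<and> length \<alpha>s = weyl_length L ip \<Phi> w"

definition subroot_lattice :: "'a::real_vector list \<Rightarrow> 'a set" where
  "subroot_lattice \<alpha>s = group_closure (set \<alpha>s)"

text \<open>\<open>L\<^sub>1 + group_closure (set \<beta>s)\<close> is the elementwise sum of sets.\<close>

definition k2 :: "'a::real_vector set \<Rightarrow> 'a set \<Rightarrow> 'a set \<Rightarrow> nat" where
  "k2 L \<Phi> L\<^sub>1 =
    (LEAST k. \<exists>\<beta>s. length \<beta>s = k \<and> set \<beta>s \<subseteq> \<Phi> \<and> L = L\<^sub>1 + group_closure (set \<beta>s))"

definition k4 ::
    "'a::real_vector set \<Rightarrow> ('a \<Rightarrow> 'a \<Rightarrow> real) \<Rightarrow> 'a set \<Rightarrow> ('a \<Rightarrow> 'a) \<Rightarrow> nat" where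
  "k4 L ip \<Phi> w =
    (LEAST k. \<exists>\<alpha>s. reduced_presentation L ip \<Phi> w \<alpha>s \<and> k = k2 L \<Phi> (subroot_lattice \<alpha>s))"

definition k5 ::
    "'a::real_vector set \<Rightarrow> ('a \<Rightarrow> 'a \<Rightarrow> real) \<Rightarrow> 'a set \<Rightarrow> ('a \<Rightarrow> 'a) \<Rightarrow> nat" where
  "k5 L ip \<Phi> w =
    (LEAST k. \<exists>\<alpha>s. presentation L ip \<Phi> w \<alpha>s \<and>
      length \<alpha>s = weyl_length L ip \<Phi> w + 2 * k \<and> subroot_lattice \<alpha>s = L)"

end

theory Submission
  imports Defs
begin

text \<open>
  Write \<open>l\<close> for the length of \<open>w\<close>. One inequality is immediate: if a reduced presentation of \<open>w\<close>
  becomes generating after adding \<open>k\<close> roots \<open>\<beta>\<^sub>1, \<dots>, \<beta>\<^sub>k\<close>, appending the pairs \<open>(\<beta>\<^sub>j, \<beta>\<^sub>j)\<close> gives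
  a presentation of length \<open>l + 2k\<close> that generates \<open>L\<close>, because \<open>s\<^sub>\<beta> \<circ> s\<^sub>\<beta> = id\<close>.

  The converse rests on the claim that every word of linearly dependent roots sheds a pair: without
  changing the product or the generated lattice it can be rewritten, by Hurwitz moves
  \<open>(\<alpha>, \<beta>) \<mapsto> (s\<^sub>\<alpha> \<beta>, \<alpha>)\<close> and \<open>(\<alpha>, \<beta>) \<mapsto> (\<beta>, s\<^sub>\<beta> \<alpha>)\<close>, into a word with two parallel neighbours.
  These have the same reflection, so they may be deleted from the product; one of them is an integral
  multiple of the other, so a single root \<open>\<beta>\<close> makes up for the loss in the lattice. Independent words
  are reduced (\<open>independent_imp_shortest\<close>, due to Carter), so a word of length \<open>l + 2k\<close> sheds \<open>k\<close>
  pairs until a reduced word is left, and the \<open>k\<close> roots shed complete its lattice to that of the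
  original word.

  The claim is proved without classification, in two steps.

  The first step (\<open>sheds_pair_if_fixed_vector\<close>) assumes that the product fixes a vector \<open>v\<close> that is
  not orthogonal to all letters, so that some suffix moves it. The images of \<open>v\<close> under the suffixes
  of the word form a closed walk from \<open>v\<close> to \<open>v\<close> on a sphere. Measure the height of a point \<open>x\<close> by its scalar product with \<open>v\<close>; the
  end points are the unique highest point of the sphere, so the walk has a valley. At a valley, one
  of the two Hurwitz moves on the adjacent letters raises the valley point and leaves the rest of the
  walk alone, unless the two letters are parallel (\<open>dihedral_ascent\<close>, an application of the
  inequality \<open>4 p q \<le> (p + q)\<^sup>2\<close>). Only finitely many words are available, so raising must end.

  The second step (\<open>dependent_sheds_pair\<close>) reduces the claim to the first one. Let \<open>\<alpha>\<close> be the
  first letter and \<open>w'\<close> the product of the others. If the others are dependent, argue by induction.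
  Otherwise \<open>\<alpha>\<close> lies in their span, which consists of vectors of the form \<open>w' z - z\<close>
  (\<open>independent_imp_moved\<close>). If \<open>w' z - z = \<alpha>\<close>, then \<open>w' z = z + \<alpha>\<close> and \<open>z\<close> have equal norms, hence
  are exchanged by \<open>s\<^sub>\<alpha>\<close>: the vector \<open>z\<close> is fixed by the whole product and not orthogonal to \<open>\<alpha>\<close>.
\<close>

section \<open>Subgroups generated by a set\<close>

lemma group_closure_least: "S \<subseteq> group_closure T \<Longrightarrow> group_closure S \<subseteq> group_closure T"
proof
  fix x assume "S \<subseteq> group_closure T" "x \<in> group_closure S"
  from this(2,1) show "x \<in> group_closure T"
    by induction (auto intro: group_closure.diff)
qed

lemma group_closure_superset: "S \<subseteq> group_closure S"
  by (auto intro: group_closure.base)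

lemma group_closure_mono: "S \<subseteq> T \<Longrightarrow> group_closure S \<subseteq> group_closure T"
  by (meson group_closure_least group_closure_superset subset_trans)

lemma group_closure_eqI:
  "S \<subseteq> group_closure T \<Longrightarrow> T \<subseteq> group_closure S \<Longrightarrow> group_closure S = group_closure T"
  by (simp add: group_closure_least subset_antisym)

lemma group_closure_Un_cong:
  assumes "group_closure S = group_closure T"
  shows "group_closure (A \<union> S) = group_closure (A \<union> T)"
  by (rule group_closure_eqI)
    (use assms group_closure_superset[of S] group_closure_superset[of T]
        group_closure_superset[of "A \<union> S"] group_closure_superset[of "A \<union> T"]
        group_closure_mono[of T "A \<union> T"] group_closure_mono[of S "A \<union> S"] in blast)+

lemma group_closure_Un: "group_closure (S \<union> T) = group_closure S + group_closure T"
proof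
  show "group_closure (S \<union> T) \<subseteq> group_closure S + group_closure T"
  proof
    fix x assume "x \<in> group_closure (S \<union> T)"
    then show "x \<in> group_closure S + group_closure T"
    proof induction
      case (base s)
      then show ?case
        using set_plus_intro[of s "group_closure S" 0 "group_closure T"]
          set_plus_intro[of 0 "group_closure S" s "group_closure T"]
        by (auto intro: group_closure.base)
    next
      case (diff s t)
      then obtain a b c d where "s = a + b" "t = c + d" "a \<in> group_closure S"
        "c \<in> group_closure S" "b \<in> group_closure T" "d \<in> group_closure T"
        by (auto elim!: set_plus_elim)
      moreover have "(a + b) - (c + d) = (a - c) + (b - d)" by simp
      ultimately show ?case
        by (metis group_closure.diff set_plus_intro)
    qed
  qed
  show "group_closure S + group_closure T \<subseteq> group_closure (S \<union> T)"
    using group_closure_mono[of S "S \<union> T"] group_closure_mono[of T "S \<union> T"]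
    by (auto elim!: set_plus_elim intro!: group_closure_add)
qed

lemma group_closure_Ints_scale:
  fixes x :: "'a::real_vector"
  assumes "x \<in> group_closure S" "c \<in> \<int>"
  shows "c *\<^sub>R x \<in> group_closure S"
proof -
  have nat: "of_nat n *\<^sub>R x \<in> group_closure S" for n
    using assms(1) by (induction n) (simp_all add: scaleR_left_distrib group_closure_add)
  obtain k where k: "c = of_int k" using assms(2) by (elim Ints_cases)
  show ?thesis
  proof (cases k)
    case (nonneg n)
    then show ?thesis using nat k by simp
  next
    case (neg n)
    then show ?thesis using nat[of "Suc n"] k by (metis group_closure_minus_iff of_int_minus
          of_int_of_nat_eq scaleR_minus_left)
  qed
qed

lemma group_closure_subset_span: "group_closure S \<subseteq> span S"
proof
  fix x assume "x \<in> group_closure S"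
  then show "x \<in> span S"
    by induction (auto intro: span_base span_zero span_diff)
qed

section \<open>Reflections in a space with a scalar product\<close>

text \<open>
  The reflection as a map on the whole vector space. The fixed vectors that the argument needs
  are found by linear algebra in the real span of the lattice and need not be lattice vectors.
\<close>

definition mirror :: "('a::real_vector \<Rightarrow> 'a \<Rightarrow> real) \<Rightarrow> 'a \<Rightarrow> 'a \<Rightarrow> 'a" where
  "mirror ip \<alpha> x = x - root_pairing ip x \<alpha> *\<^sub>R \<alpha>"

locale inner_subspace =
  fixes V :: "'a::real_vector set" and ip :: "'a \<Rightarrow> 'a \<Rightarrow> real"
  assumes V: "subspace V" and sp: "scalar_product_on V ip"
begin

abbreviation s where "s \<equiv> mirror ip"

definition act :: "'a list \<Rightarrow> 'a \<Rightarrow> 'a" where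
  "act as x = foldr s as x"

lemma act_Nil [simp]: "act [] x = x"
  and act_Cons [simp]: "act (a # as) x = s a (act as x)"
  and act_append [simp]: "act (as @ bs) x = act as (act bs x)"
  by (simp_all add: act_def)

lemma V_closed [simp, intro]:
  "0 \<in> V" "x \<in> V \<Longrightarrow> y \<in> V \<Longrightarrow> x + y \<in> V" "x \<in> V \<Longrightarrow> y \<in> V \<Longrightarrow> x - y \<in> V"
  "x \<in> V \<Longrightarrow> c *\<^sub>R x \<in> V"
  using V by (auto simp: subspace_0 subspace_add subspace_diff subspace_scale)

lemma ip_sym: "x \<in> V \<Longrightarrow> y \<in> V \<Longrightarrow> ip x y = ip y x"
  using sp unfolding scalar_product_on_def by blast

lemma ip_add: "x \<in> V \<Longrightarrow> y \<in> V \<Longrightarrow> z \<in> V \<Longrightarrow> ip (x + y) z = ip x z + ip y z"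
  using sp unfolding scalar_product_on_def by blast

lemma ip_scale: "x \<in> V \<Longrightarrow> y \<in> V \<Longrightarrow> ip (c *\<^sub>R x) y = c * ip x y"
  using sp unfolding scalar_product_on_def by blast

lemma ip_pos: "x \<in> V \<Longrightarrow> x \<noteq> 0 \<Longrightarrow> ip x x > 0"
  using sp unfolding scalar_product_on_def by blast

lemma ip_zero: "x \<in> V \<Longrightarrow> ip 0 x = 0"
  using ip_scale[of x x 0] by simp

lemma ip_diff: "x \<in> V \<Longrightarrow> y \<in> V \<Longrightarrow> z \<in> V \<Longrightarrow> ip (x - y) z = ip x z - ip y z"
  using ip_add[of "x - y" y z] by auto

lemma ip_right:
  "x \<in> V \<Longrightarrow> y \<in> V \<Longrightarrow> z \<in> V \<Longrightarrow> ip z (x + y) = ip z x + ip z y"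
  "x \<in> V \<Longrightarrow> y \<in> V \<Longrightarrow> z \<in> V \<Longrightarrow> ip z (x - y) = ip z x - ip z y"
  "x \<in> V \<Longrightarrow> z \<in> V \<Longrightarrow> ip z (c *\<^sub>R x) = c * ip z x"
  using ip_sym[of z] by (auto simp: ip_add ip_diff ip_scale)

lemmas ip_simps = ip_add ip_diff ip_scale ip_right

lemma orthogonal_to_span:
  assumes "S \<subseteq> V" "z \<in> V" "\<And>x. x \<in> S \<Longrightarrow> ip z x = 0" "y \<in> span S"
  shows "ip z y = 0"
proof -
  have "subspace {y \<in> V. ip z y = 0}"
    using assms(2) ip_zero[of z] ip_sym[of z 0] by (auto simp: subspace_def ip_right)
  moreover have "S \<subseteq> {y \<in> V. ip z y = 0}" using assms by auto
  ultimately have "span S \<subseteq> {y \<in> V. ip z y = 0}" by (metis span_minimal)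
  then show ?thesis using assms(4) by auto
qed

lemma s_in_V [simp, intro]: "a \<in> V \<Longrightarrow> x \<in> V \<Longrightarrow> s a x \<in> V"
  by (simp add: mirror_def)

lemma act_in_V [simp, intro]: "set as \<subseteq> V \<Longrightarrow> x \<in> V \<Longrightarrow> act as x \<in> V"
  by (induction as) auto

lemma pairing_add:
  "a \<in> V \<Longrightarrow> x \<in> V \<Longrightarrow> y \<in> V \<Longrightarrow>
    root_pairing ip (x + y) a = root_pairing ip x a + root_pairing ip y a"
  by (simp add: root_pairing_def ip_add distrib_left add_divide_distrib)

lemma pairing_diff:
  "a \<in> V \<Longrightarrow> x \<in> V \<Longrightarrow> y \<in> V \<Longrightarrow>
    root_pairing ip (x - y) a = root_pairing ip x a - root_pairing ip y a"
  by (simp add: root_pairing_def ip_diff right_diff_distrib diff_divide_distrib)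

lemma pairing_scale:
  "a \<in> V \<Longrightarrow> x \<in> V \<Longrightarrow> root_pairing ip (c *\<^sub>R x) a = c * root_pairing ip x a"
  by (simp add: root_pairing_def ip_scale)

lemma pairing_self: "a \<in> V \<Longrightarrow> a \<noteq> 0 \<Longrightarrow> root_pairing ip a a = 2"
  using ip_pos[of a] by (simp add: root_pairing_def)

lemma s_add: "a \<in> V \<Longrightarrow> x \<in> V \<Longrightarrow> y \<in> V \<Longrightarrow> s a (x + y) = s a x + s a y"
  by (simp add: mirror_def pairing_add scaleR_left_distrib)

lemma s_scale: "a \<in> V \<Longrightarrow> x \<in> V \<Longrightarrow> s a (c *\<^sub>R x) = c *\<^sub>R s a x"
  by (simp add: mirror_def pairing_scale scaleR_right_diff_distrib)

lemma act_add: "set as \<subseteq> V \<Longrightarrow> x \<in> V \<Longrightarrow> y \<in> V \<Longrightarrow> act as (x + y) = act as x + act as y"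
  by (induction as) (auto simp: s_add)

lemma act_scale: "set as \<subseteq> V \<Longrightarrow> x \<in> V \<Longrightarrow> act as (c *\<^sub>R x) = c *\<^sub>R act as x"
  by (induction as) (auto simp: s_scale)

lemma s_isometry:
  assumes "a \<in> V" "a \<noteq> 0" "x \<in> V" "y \<in> V"
  shows "ip (s a x) (s a y) = ip x y"
proof -
  define p where "p = root_pairing ip x a"
  define q where "q = root_pairing ip y a"
  have "ip a a \<noteq> 0" using ip_pos[OF assms(1,2)] by simp
  then have pq: "p * ip a a = 2 * ip x a" "q * ip a a = 2 * ip y a"
    by (auto simp: p_def q_def root_pairing_def)
  have "ip (s a x) (s a y) = ip x y - q * ip x a - p * ip y a + q * (p * ip a a)"
    using assms ip_sym[of a y] unfolding mirror_def p_def[symmetric] q_def[symmetric]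
    by (simp add: ip_simps algebra_simps)
  also have "q * (p * ip a a) = q * ip x a + p * ip y a"
  proof -
    have "2 * (q * (p * ip a a)) = q * (p * ip a a) + p * (q * ip a a)" by (simp add: algebra_simps)
    also have "\<dots> = 2 * (q * ip x a + p * ip y a)" unfolding pq by (simp add: algebra_simps)
    finally show ?thesis by simp
  qed
  finally show ?thesis by simp
qed

lemma act_isometry:
  assumes "set as \<subseteq> V - {0}" "x \<in> V" "y \<in> V"
  shows "ip (act as x) (act as y) = ip x y"
proof -
  have "set as \<subseteq> V" using assms by auto
  then show ?thesis using assms by (induction as) (auto simp: s_isometry)
qed

lemma pairing_s:
  assumes "a \<in> V" "a \<noteq> 0" "x \<in> V"
  shows "root_pairing ip (s a x) a = - root_pairing ip x a"
  using assms by (simp add: mirror_def pairing_diff pairing_scale pairing_self)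

lemma s_involution:
  assumes "a \<in> V" "a \<noteq> 0" "x \<in> V"
  shows "s a (s a x) = x"
  using pairing_s[OF assms] by (simp add: mirror_def)

lemma pairing_isometry:
  assumes "a \<in> V" "a \<noteq> 0" "x \<in> V" "b \<in> V"
  shows "root_pairing ip (s a x) (s a b) = root_pairing ip x b"
  using assms by (simp add: root_pairing_def s_isometry)

text \<open>
  The identity \<open>s\<^bsub>s\<^sub>a b\<^esub> = s\<^sub>a \<circ> s\<^sub>b \<circ> s\<^sub>a\<close>, composed with \<open>s\<^sub>a\<close> on the right: Hurwitz moves
  preserve products.
\<close>

lemma s_conjugate:
  assumes "a \<in> V" "a \<noteq> 0" "b \<in> V" "x \<in> V"
  shows "s (s a b) (s a x) = s a (s b x)"
proof -
  have "s (s a b) (s a x) = s a x - root_pairing ip x b *\<^sub>R s a b"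
    using assms by (simp add: mirror_def[of ip "s a b"] pairing_isometry)
  also have "\<dots> = s a x + s a ((- root_pairing ip x b) *\<^sub>R b)"
    using assms by (subst s_scale) auto
  also have "\<dots> = s a (x + (- root_pairing ip x b) *\<^sub>R b)"
    using assms by (intro s_add[symmetric] V_closed(4))
  also have "\<dots> = s a (s b x)"
    by (simp add: mirror_def[of ip b])
  finally show ?thesis .
qed

lemma s_parallel:
  assumes "b \<in> V" "b \<noteq> 0" "c \<noteq> 0" "x \<in> V"
  shows "s (c *\<^sub>R b) x = s b x"
  using assms ip_pos[OF assms(1,2)] by (simp add: mirror_def root_pairing_def ip_simps)

lemma act_minus_in_span: "act as x - x \<in> span (set as)"
proof (induction as)
  case (Cons a as)
  have "act (a # as) x - x = (act as x - x) - root_pairing ip (act as x) a *\<^sub>R a"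
    by (simp add: mirror_def)
  also have "\<dots> \<in> span (set (a # as))"
  proof (rule span_diff)
    show "act as x - x \<in> span (set (a # as))"
      using Cons span_mono[of "set as" "set (a # as)"] by auto
  qed (auto intro: span_scale span_base)
  finally show ?case .
qed (simp add: span_zero)

lemma act_fixes_orthogonal:
  assumes "\<And>a. a \<in> set as \<Longrightarrow> ip x a = 0"
  shows "act as x = x"
  using assms by (induction as) (auto simp: mirror_def root_pairing_def)

text \<open>
  The case of equality in the Cauchy--Schwarz inequality: the product of the two pairings is
  \<open>4 cos\<^sup>2 \<theta>\<close>, where \<open>\<theta>\<close> is the angle between the vectors.
\<close>

lemma parallel_if_pairing_product:
  assumes "a \<in> V" "b \<in> V" "b \<noteq> 0" "a \<noteq> 0"
    and "root_pairing ip a b * root_pairing ip b a \<ge> 4"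
  obtains c where "a = c *\<^sub>R b"
proof -
  \<comment> \<open>the component of \<open>a\<close> orthogonal to \<open>b\<close>\<close>
  define z where "z = a - (ip a b / ip b b) *\<^sub>R b"
  have pos: "ip a a > 0" "ip b b > 0" using assms ip_pos by auto
  have z: "z \<in> V" using assms by (simp add: z_def)
  have "ip z z = ip a a - (ip a b)\<^sup>2 / ip b b"
    using assms pos ip_sym[of b a]
    by (simp add: z_def ip_simps field_simps power2_eq_square)
  also have "\<dots> \<le> 0"
    using assms pos ip_sym[of b a]
    by (simp add: root_pairing_def field_simps power2_eq_square)
  finally have "z = 0" using ip_pos[OF z] by force
  then show ?thesis using that by (auto simp: z_def)
qed

lemma orthogonal_projection:
  assumes "finite S" "S \<subseteq> V" "b \<in> V"
  shows "\<exists>z\<in>V. b - z \<in> span S \<and> (\<forall>x\<in>S. ip z x = 0)"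
  using assms
proof (induction arbitrary: b)
  case empty
  then show ?case by (intro bexI[of _ b]) (auto simp: span_zero)
next
  case (insert t S)
  then have IH: "\<exists>z\<in>V. b - z \<in> span S \<and> (\<forall>x\<in>S. ip z x = 0)" if "b \<in> V" for b
    using that by simp
  obtain u where u: "u \<in> V" "t - u \<in> span S" "\<forall>x\<in>S. ip u x = 0"
    using IH[of t] insert.prems by auto
  obtain z where z: "z \<in> V" "b - z \<in> span S" "\<forall>x\<in>S. ip z x = 0"
    using IH[of b] insert.prems by auto
  define c where "c = ip z u / ip u u"
  have mono: "span S \<subseteq> span (insert t S)" by (intro span_mono) auto
  have "u = t - (t - u)" by simp
  then have "u \<in> span (insert t S)" using u mono by (metis insertI1 span_base span_diff subsetD)
  then have "(b - z) + c *\<^sub>R u \<in> span (insert t S)" using z mono by (auto intro: span_add span_scale)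
  then have 1: "b - (z - c *\<^sub>R u) \<in> span (insert t S)" by (simp add: algebra_simps)
  have zu: "ip (z - c *\<^sub>R u) u = 0"
    using u z ip_pos[of u] ip_zero ip_sym[of z u] by (cases "u = 0") (auto simp: c_def ip_simps)
  have orthS: "ip (z - c *\<^sub>R u) x = 0" if "x \<in> S" for x
    using that u z insert.prems by (auto simp: ip_simps subset_iff)
  have "ip (z - c *\<^sub>R u) (t - u) = 0"
    using orthogonal_to_span[of S "z - c *\<^sub>R u"] orthS u z insert.prems by auto
  then have "ip (z - c *\<^sub>R u) t = 0"
    using zu u z insert.prems by (simp add: ip_right)
  with 1 orthS u z show ?case by (intro bexI[of _ "z - c *\<^sub>R u"]) auto
qed

text \<open>
  Induction on the word. For a first letter \<open>b\<close> outside the span of the others, the component \<open>u\<close>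
  of \<open>b\<close> orthogonal to that span is fixed by the other reflections and moved by \<open>s\<^sub>b\<close> along \<open>b\<close>; so
  \<open>b\<close> is reached. A vector reached by the shorter word is reached up to a multiple of \<open>b\<close>, which
  a multiple of \<open>u\<close> corrects.
\<close>

lemma independent_imp_moved:
  assumes "distinct as" "independent (set as)" "set as \<subseteq> V - {0}" "y \<in> span (set as)"
  shows "\<exists>z\<in>V. act as z - z = y"
  using assms
proof (induction as arbitrary: y)
  case Nil
  then show ?case by (auto simp: span_empty)
next
  case (Cons b bs)
  have ind: "independent (set bs)" "b \<notin> span (set bs)"
    using Cons.prems by (auto simp: independent_insert)
  have bV: "b \<in> V" "b \<noteq> 0" and bsV: "set bs \<subseteq> V" using Cons.prems by auto
  obtain u where u: "u \<in> V" "b - u \<in> span (set bs)" "\<forall>x\<in>set bs. ip u x = 0"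
    using orthogonal_projection[of "set bs" b] bsV bV by auto
  have "u \<noteq> 0" using u ind by auto
  have "ip u (b - u) = 0" using orthogonal_to_span[of "set bs" u] u bsV by auto
  then have "ip u b = ip u u" using u bV by (simp add: ip_right)
  then have ub: "ip u b \<noteq> 0" using ip_pos[OF u(1) \<open>u \<noteq> 0\<close>] by simp
  have pos: "ip b b > 0" using ip_pos bV by auto
  define d where "d = root_pairing ip u b"
  have d: "d \<noteq> 0" using ub pos by (simp add: d_def root_pairing_def)
  have move_u: "act (b # bs) u - u = - (d *\<^sub>R b)"
    using act_fixes_orthogonal[of bs u] u by (simp add: mirror_def d_def)
  obtain k where k: "y - k *\<^sub>R b \<in> span (set bs)"
    using Cons.prems(4) span_breakdown_eq[of y b "set bs"] by auto
  then obtain z where z: "z \<in> V" "act bs z - z = y - k *\<^sub>R b"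
    using Cons.IH[of "y - k *\<^sub>R b"] Cons.prems ind by auto
  define e where "e = root_pairing ip (act bs z) b"
  have move_z: "act (b # bs) z - z = y - (k + e) *\<^sub>R b"
    using z by (simp add: mirror_def e_def algebra_simps)
  define c where "c = - ((k + e) / d)"
  have "act (b # bs) (z + c *\<^sub>R u) - (z + c *\<^sub>R u)
      = (act (b # bs) z - z) + c *\<^sub>R (act (b # bs) u - u)"
    using z u Cons.prems by (subst act_add) (auto simp: act_scale s_scale bsV bV algebra_simps)
  also have "\<dots> = y - (k + e + c * d) *\<^sub>R b"
    by (simp only: move_z move_u) (simp add: algebra_simps)
  also have "\<dots> = y" using d by (simp add: c_def)
  finally show ?case using z u by blast
qed

text \<open>
  The vectors \<open>w z - z\<close> lie in the span of any word with product \<open>w\<close>, and fill the span of an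
  independent one; compare dimensions.
\<close>

lemma independent_imp_shortest:
  assumes "distinct as" "independent (set as)" "set as \<subseteq> V - {0}"
    and "\<And>x. x \<in> V \<Longrightarrow> act bs x = act as x"
  shows "length as \<le> length bs"
proof -
  have "set as \<subseteq> span (set bs)"
  proof
    fix a assume "a \<in> set as"
    then obtain z where "z \<in> V" "act as z - z = a"
      using independent_imp_moved[OF assms(1-3)] span_base by blast
    then show "a \<in> span (set bs)" using act_minus_in_span[of bs z] assms(4) by simp
  qed
  then have "card (set as) \<le> card (set bs)"
    using independent_span_bound[of "set bs" "set as"] assms by auto
  then show ?thesis
    using distinct_card[OF assms(1)] card_length[of bs] by simp
qed

text \<open>
  The two elements of the conclusion are the positions to which the two Hurwitz moves on \<open>(a, b)\<close>
  carry the valley point \<open>x\<close>. Let \<open>q\<close> and \<open>p\<close> be the climbs from \<open>x\<close> to its neighbours. The moves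
  change the height of \<open>x\<close> by \<open>p + q - U\<close> and \<open>p + q - W\<close>, where
  \<open>U W = \<langle>a, b\<rangle> \<langle>b, a\<rangle> p q\<close>. If both changes were nonpositive, multiplying would give
  \<open>(p + q)\<^sup>2 \<le> \<langle>a, b\<rangle> \<langle>b, a\<rangle> p q\<close> with a coefficient below \<open>4\<close>, which is
  incompatible with \<open>4 p q \<le> (p + q)\<^sup>2\<close> if \<open>p > 0\<close>, and with \<open>q > 0\<close> if \<open>p = 0\<close>.
\<close>

lemma dihedral_ascent:
  assumes a: "a \<in> V" "a \<noteq> 0" and b: "b \<in> V" "b \<noteq> 0" and x: "x \<in> V" and v: "v \<in> V"
    and nonparallel: "root_pairing ip a b * root_pairing ip b a < 4"
    and le: "ip x v \<le> ip (s a x) v" and less: "ip x v < ip (s b x) v"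
  shows "ip x v < ip (s a (s b x)) v \<or> ip x v < ip (s b (s a x)) v"
proof (rule ccontr)
  let ?n = "root_pairing ip"
  assume "\<not> ?thesis"
  then have *: "ip (s a (s b x)) v \<le> ip x v" "ip (s b (s a x)) v \<le> ip x v" by auto
  define p where "p = - (?n x a * ip a v)"
  define q where "q = - (?n x b * ip b v)"
  have p: "p \<ge> 0" and q: "q > 0"
    using le less a b x v by (auto simp: p_def q_def mirror_def ip_simps)
  have n: "?n (s b x) a = ?n x a - ?n x b * ?n b a" "?n (s a x) b = ?n x b - ?n x a * ?n a b"
    using a b x by (simp_all add: mirror_def pairing_diff pairing_scale)
  have "ip (s a (s b x)) v = ip (s b x) v - ?n (s b x) a * ip a v"
    using a b x v by (simp add: mirror_def[of ip a "s b x"] ip_simps)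
  also have "\<dots> = ip x v + p + q + ?n x b * ?n b a * ip a v"
    unfolding n using b x v by (simp add: p_def q_def mirror_def ip_simps algebra_simps)
  finally have U: "p + q \<le> - (?n x b * ?n b a * ip a v)" using * by simp
  have "ip (s b (s a x)) v = ip (s a x) v - ?n (s a x) b * ip b v"
    using a b x v by (simp add: mirror_def[of ip b "s a x"] ip_simps)
  also have "\<dots> = ip x v + p + q + ?n x a * ?n a b * ip b v"
    unfolding n using a x v by (simp add: p_def q_def mirror_def ip_simps algebra_simps)
  finally have W: "p + q \<le> - (?n x a * ?n a b * ip b v)" using * by simp
  have "(p + q) * (p + q) \<le> - (?n x b * ?n b a * ip a v) * - (?n x a * ?n a b * ip b v)"
    using U W p q by (intro mult_mono) auto
  also have "\<dots> = (?n a b * ?n b a) * (p * q)"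
    by (simp add: p_def q_def algebra_simps)
  finally have 1: "(p + q) * (p + q) \<le> (?n a b * ?n b a) * (p * q)" .
  have 2: "4 * (p * q) \<le> (p + q) * (p + q)"
    using zero_le_square[of "p - q"] by (simp add: algebra_simps)
  show False
  proof (cases "p = 0")
    case True
    then show ?thesis using 1 q by (simp add: mult_le_0_iff)
  next
    case False
    then have "p * q > 0" using p q by simp
    then have "(?n a b * ?n b a) * (p * q) < 4 * (p * q)"
      using nonparallel by (intro mult_strict_right_mono)
    then show ?thesis using 1 2 by linarith
  qed
qed

text \<open>
  The sum of the heights over the walk of \<open>v\<close> under the suffixes of the word. A rewriting that
  changes one point of the walk changes the sum by the change at that point.
\<close>

fun height :: "'a \<Rightarrow> 'a list \<Rightarrow> real" where
  "height v [] = 0"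
| "height v (a # as) = ip (act (a # as) v) v + height v as"

lemma height_append:
  "act bs v = act bs' v \<Longrightarrow> height v (as @ bs) - height v (as @ bs') = height v bs - height v bs'"
  by (induction as) auto

end

text \<open>
  A minimum point of largest index is strictly below its right neighbour. Strictness on one side
  is what a single move needs in order to increase the total height.
\<close>

lemma valley_exists:
  fixes f :: "nat \<Rightarrow> real"
  assumes "j \<le> m" "f j < f 0" "f j < f m"
  obtains i where "0 < i" "i < m" "f i \<le> f (i - 1)" "f i < f (i + 1)"
proof -
  define c where "c = Min (f ` {0..m})"
  define A where "A = {i \<in> {0..m}. f i = c}"
  have c: "c \<le> f i" if "i \<le> m" for i unfolding c_def using that by (intro Min_le) auto
  have "c \<in> f ` {0..m}" unfolding c_def by (intro Min_in) auto
  then have A: "finite A" "A \<noteq> {}" by (auto simp: A_def)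
  define i where "i = Max A"
  have "i \<in> A" unfolding i_def using A by simp
  then have i: "i \<le> m" "f i = c" by (auto simp: A_def)
  have "i \<noteq> 0" "i \<noteq> m" using i c[OF assms(1)] assms by (metis leD)+
  moreover have "f i \<le> f (i - 1)" using i c[of "i - 1"] by auto
  moreover have "f i < f (i + 1)"
  proof -
    have "i + 1 \<notin> A" using Max_ge[OF A(1), of "i + 1"] unfolding i_def by linarith
    then show ?thesis using i \<open>i \<noteq> m\<close> c[of "i + 1"] by (force simp: A_def)
  qed
  ultimately show ?thesis using that[of i] i by auto
qed

section \<open>Hurwitz moves and shedding parallel letters\<close>

locale root_system = inner_subspace +
  fixes \<Phi> :: "'a set"
  assumes finite_roots: "finite \<Phi>" and roots: "\<Phi> \<subseteq> V - {0}"
    and s_root: "\<And>a b. a \<in> \<Phi> \<Longrightarrow> b \<in> \<Phi> \<Longrightarrow> s a b \<in> \<Phi>"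
    and pairing_Ints: "\<And>a b. a \<in> \<Phi> \<Longrightarrow> b \<in> \<Phi> \<Longrightarrow> root_pairing ip b a \<in> \<int>"
begin

lemma root [simp]: "a \<in> \<Phi> \<Longrightarrow> a \<in> V" "a \<in> \<Phi> \<Longrightarrow> a \<noteq> 0"
  using roots by auto

definition same_lattice_word :: "'a list \<Rightarrow> 'a list \<Rightarrow> bool" where
  "same_lattice_word as bs \<longleftrightarrow> set bs \<subseteq> \<Phi> \<and> length bs = length as \<and>
     (\<forall>x\<in>V. act bs x = act as x) \<and> group_closure (set bs) = group_closure (set as)"

text \<open>
  A word is replaced by one with two letters fewer and the same product, at the price of one
  extra root in the generated lattice.
\<close>

definition sheds_pair :: "'a list \<Rightarrow> bool" where
  "sheds_pair as \<longleftrightarrow> (\<exists>bs \<beta>. length as = length bs + 2 \<and> set bs \<subseteq> \<Phi> \<and> \<beta> \<in> \<Phi> \<and>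
     (\<forall>x\<in>V. act bs x = act as x) \<and> group_closure (set as) = group_closure (insert \<beta> (set bs)))"

lemma sheds_pair_cong:
  assumes "same_lattice_word as bs" "sheds_pair bs"
  shows "sheds_pair as"
  using assms unfolding same_lattice_word_def sheds_pair_def by metis

text \<open>
  By integrality \<open>s\<^sub>a b\<close> differs from \<open>b\<close> by an integral multiple of \<open>a\<close>, so Hurwitz moves preserve
  the lattice.
\<close>

lemma group_closure_reflect:
  assumes "a \<in> \<Phi>" "b \<in> \<Phi>" "a \<in> S"
  shows "group_closure (insert (s a b) S) = group_closure (insert b S)"
proof -
  define n where "n = root_pairing ip b a *\<^sub>R a"
  have n: "n \<in> group_closure T" if "S \<subseteq> T" for T
    unfolding n_def using that assms
    by (intro group_closure_Ints_scale group_closure.base) (auto intro: pairing_Ints)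
  have sn: "s a b = b - n" by (simp add: mirror_def n_def)
  show ?thesis
  proof (rule group_closure_eqI)
    show "insert (s a b) S \<subseteq> group_closure (insert b S)"
      using n[of "insert b S"] unfolding sn by (auto intro: group_closure.intros)
    have "(b - n) + n \<in> group_closure (insert (s a b) S)"
      using n[of "insert (s a b) S"] unfolding sn
      by (intro group_closure_add) (auto intro: group_closure.intros)
    then show "insert b S \<subseteq> group_closure (insert (s a b) S)"
      by (auto intro: group_closure.intros)
  qed
qed

lemma hurwitz_left:
  assumes "set (us @ a # b # vs) \<subseteq> \<Phi>"
  shows "same_lattice_word (us @ a # b # vs) (us @ s a b # a # vs)"
proof -
  have 1: "set vs \<subseteq> V" using assms by auto
  have "act (us @ s a b # a # vs) x = act (us @ a # b # vs) x" if "x \<in> V" for x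
    using that assms 1 by (simp add: s_conjugate)
  moreover have "group_closure (set (us @ s a b # a # vs)) = group_closure (set (us @ a # b # vs))"
    using group_closure_reflect[of a b "insert a (set us \<union> set vs)"] assms
    by (simp add: insert_commute)
  ultimately show ?thesis
    unfolding same_lattice_word_def using assms s_root by simp
qed

lemma hurwitz_right:
  assumes "set (us @ a # b # vs) \<subseteq> \<Phi>"
  shows "same_lattice_word (us @ a # b # vs) (us @ b # s b a # vs)"
proof -
  have 1: "set vs \<subseteq> V" using assms by auto
  have "act (us @ b # s b a # vs) x = act (us @ a # b # vs) x" if "x \<in> V" for x
  proof -
    have y: "act vs x \<in> V" using that 1 by auto
    have "s b (s (s b a) (act vs x)) = s b (s (s b a) (s b (s b (act vs x))))"
      using assms y by (simp add: s_involution)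
    also have "\<dots> = s b (s b (s a (s b (act vs x))))"
      using assms y s_conjugate[of b a "s b (act vs x)"] by simp
    also have "\<dots> = s a (s b (act vs x))"
      using assms y by (simp add: s_involution)
    finally show ?thesis by simp
  qed
  moreover have "group_closure (set (us @ b # s b a # vs)) = group_closure (set (us @ a # b # vs))"
    using group_closure_reflect[of b a "insert b (set us \<union> set vs)"] assms
    by (simp add: insert_commute)
  ultimately show ?thesis
    unfolding same_lattice_word_def using assms s_root by simp
qed

lemma same_lattice_word_refl: "set as \<subseteq> \<Phi> \<Longrightarrow> same_lattice_word as as"
  by (simp add: same_lattice_word_def)

lemma same_lattice_word_trans:
  "same_lattice_word as bs \<Longrightarrow> same_lattice_word bs cs \<Longrightarrow> same_lattice_word as cs"
  by (auto simp: same_lattice_word_def)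

text \<open>
  The pairings \<open>2 c\<close> and \<open>2 / c\<close> are integers with product \<open>4\<close>, so one of them is even. Proportional
  roots \<open>\<alpha>\<close>, \<open>2 \<alpha>\<close> do occur in nonreduced systems; of such two, the shorter generates both.
\<close>

lemma parallel_roots_multiple:
  assumes "a \<in> \<Phi>" "b \<in> \<Phi>" "a = c *\<^sub>R b"
  shows "c \<in> \<int> \<or> inverse c \<in> \<int>"
proof -
  have pos: "ip b b > 0" using assms ip_pos by auto
  have c: "c \<noteq> 0" using assms root(2)[of a] by auto
  have "root_pairing ip a b = 2 * c" "root_pairing ip b a = 2 * inverse c"
    using pos c assms(2,3) by (auto simp: root_pairing_def ip_simps field_simps)
  then obtain m n :: int where m: "2 * c = of_int m" and n: "2 * inverse c = of_int n"
    using pairing_Ints assms by (metis Ints_cases)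
  have "of_int (m * n) = (of_int 4 :: real)" using m n c by (simp flip: m n)
  then have mn: "m * n = 4" by (simp only: of_int_eq_iff)
  show ?thesis
  proof (cases "even m")
    case True
    then obtain k where "m = 2 * k" by auto
    then have "c = of_int k" using m by simp
    then show ?thesis by simp
  next
    case False
    then have "even n" using mn by (metis even_mult_iff even_numeral)
    then obtain k where "n = 2 * k" by auto
    then have "inverse c = of_int k" using n by simp
    then show ?thesis by (metis Ints_of_int)
  qed
qed

lemma sheds_parallel_neighbours:
  assumes as: "set (us @ a # b # vs) \<subseteq> \<Phi>" and "a = c *\<^sub>R b"
  shows "sheds_pair (us @ a # b # vs)"
proof -
  have ab: "a \<in> \<Phi>" "b \<in> \<Phi>" and vs: "set vs \<subseteq> V" using as by auto
  have c: "c \<noteq> 0" using assms(2) root(2)[OF ab(1)] by auto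
  have act: "act (us @ vs) x = act (us @ a # b # vs) x" if "x \<in> V" for x
  proof -
    have y: "act vs x \<in> V" using that vs by auto
    then have "s a (s b (act vs x)) = act vs x"
      using assms(2) ab c by (metis root s_in_V s_involution s_parallel)
    then show ?thesis by simp
  qed
  have "\<exists>\<beta>\<in>{a, b}. {a, b} \<subseteq> group_closure {\<beta>}"
    using parallel_roots_multiple[OF ab assms(2)]
  proof
    assume "c \<in> \<int>"
    then have "a \<in> group_closure {b}"
      unfolding assms(2) by (intro group_closure_Ints_scale) (auto intro: group_closure.base)
    then show ?thesis by (auto intro: group_closure.base)
  next
    assume "inverse c \<in> \<int>"
    then have "inverse c *\<^sub>R a \<in> group_closure {a}"
      by (intro group_closure_Ints_scale) (auto intro: group_closure.base)
    then have "b \<in> group_closure {a}" unfolding assms(2) using c by simp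
    then show ?thesis by (auto intro: group_closure.base)
  qed
  then obtain \<beta> where \<beta>: "\<beta> \<in> {a, b}" "{a, b} \<subseteq> group_closure {\<beta>}" by blast
  then have "group_closure {a, b} = group_closure {\<beta>}"
    by (intro group_closure_eqI) (auto intro: group_closure.base)
  from group_closure_Un_cong[OF this, of "set us \<union> set vs"]
  have "group_closure (set (us @ a # b # vs)) = group_closure (insert \<beta> (set (us @ vs)))"
    by (simp add: Un_commute insert_commute)
  moreover have "\<beta> \<in> \<Phi>" using \<beta> ab by auto
  ultimately show ?thesis
    unfolding sheds_pair_def using act as
    by (intro exI[of _ "us @ vs"] exI[of _ \<beta>]) auto
qed

text \<open>
  If the walk never dropped below its end points, it would be constant, since \<open>v\<close> is the only point
  of its sphere at height at least \<open>ip v v\<close>; then every letter would be orthogonal to \<open>v\<close>.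
\<close>

lemma valley_in_word:
  assumes as: "set as \<subseteq> \<Phi>" and v: "v \<in> V" "act as v = v" and a: "a \<in> set as" "ip v a \<noteq> 0"
  obtains us a b vs where "as = us @ a # b # vs"
    "ip (s b (act vs v)) v \<le> ip (s a (s b (act vs v))) v"
    "ip (s b (act vs v)) v < ip (act vs v) v"
proof -
  define f where "f i = ip (act (drop i as) v) v" for i
  have asV: "set (drop i as) \<subseteq> V - {0}" for i using as roots set_drop_subset[of i as] by blast
  have "\<exists>i\<le>length as. f i < ip v v"
  proof (rule ccontr)
    assume "\<not> ?thesis"
    then have ge: "ip v v \<le> f i" if "i \<le> length as" for i using that by force
    have fixed: "act (drop i as) v = v" if "i \<le> length as" for i
    proof -
      let ?x = "act (drop i as) v"
      have x: "?x \<in> V" using asV[of i] v by (intro act_in_V) auto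
      have "ip ?x ?x = ip v v" using asV[of i] v by (simp add: act_isometry)
      then have "ip (?x - v) (?x - v) \<le> 0"
        using x v ge[OF that] ip_sym[of v ?x] by (simp add: ip_simps f_def)
      then show ?thesis using ip_pos[of "?x - v"] x v by force
    qed
    obtain i where i: "i < length as" "as ! i = a" using a(1) by (auto simp: in_set_conv_nth)
    have "drop i as = a # drop (Suc i) as" using i Cons_nth_drop_Suc by metis
    then have "s a v = v" using fixed[of i] fixed[of "Suc i"] i by simp
    moreover have "a \<in> \<Phi>" using a as by auto
    ultimately show False
      using a(2) ip_pos[of a] by (auto simp: mirror_def root_pairing_def)
  qed
  then obtain j where "j \<le> length as" "f j < f 0" "f j < f (length as)"
    using v by (auto simp: f_def)
  then obtain i where i: "0 < i" "i < length as" "f i \<le> f (i - 1)" "f i < f (i + 1)"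
    by (rule valley_exists)
  obtain k where k: "i = Suc k" using i by (cases i) auto
  let ?vs = "drop (Suc (Suc k)) as"
  have d: "drop (Suc k) as = as ! Suc k # ?vs"
    using i k by (simp add: Cons_nth_drop_Suc)
  have d': "drop k as = as ! k # as ! Suc k # ?vs"
    using i k by (simp add: Cons_nth_drop_Suc)
  then have "as = take k as @ as ! k # as ! Suc k # ?vs" by (metis append_take_drop_id)
  moreover have "ip (s (as ! Suc k) (act ?vs v)) v \<le> ip (s (as ! k) (s (as ! Suc k) (act ?vs v))) v"
    using i(3) unfolding k f_def by (simp add: d d' del: drop_Suc)
  moreover have "ip (s (as ! Suc k) (act ?vs v)) v < ip (act ?vs v) v"
    using i(4) unfolding k f_def by (simp add: d del: drop_Suc)
  ultimately show ?thesis using that by blast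
qed

text \<open>
  Choose a word of greatest total height among those with the same product, length and lattice.
  Equality of the lattices keeps some letter nonorthogonal to \<open>v\<close>, so the chosen word has a valley;
  maximality excludes both ascents there, which leaves parallel neighbours.
\<close>

lemma sheds_pair_if_fixed_vector:
  assumes as: "set as \<subseteq> \<Phi>" and v: "v \<in> V" "act as v = v" and a: "a \<in> set as" "ip v a \<noteq> 0"
  shows "sheds_pair as"
proof -
  define M where "M = {bs. same_lattice_word as bs}"
  have "M \<subseteq> {bs. set bs \<subseteq> \<Phi> \<and> length bs = length as}"
    by (auto simp: M_def same_lattice_word_def)
  then have fin: "finite M"
    using finite_lists_length_eq[OF finite_roots] by (rule finite_subset)
  have ne: "M \<noteq> {}" using same_lattice_word_refl[OF as] by (auto simp: M_def)
  then have "Max (height v ` M) \<in> height v ` M" using fin by (intro Max_in) auto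
  then obtain bs where "bs \<in> M" and "height v bs = Max (height v ` M)" by auto
  then have bs: "same_lattice_word as bs" and
    max: "\<And>cs. same_lattice_word bs cs \<Longrightarrow> height v cs \<le> height v bs"
    using fin same_lattice_word_trans[of as bs] by (auto simp: M_def)
  have bsR: "set bs \<subseteq> \<Phi>" and act: "act bs v = v"
    using bs v by (auto simp: same_lattice_word_def)
  have "\<exists>b\<in>set bs. ip v b \<noteq> 0"
  proof (rule ccontr)
    assume "\<not> ?thesis"
    moreover have "a \<in> group_closure (set bs)"
      using bs a by (auto simp: same_lattice_word_def intro: group_closure.base)
    then have "a \<in> span (set bs)" using group_closure_subset_span by auto
    moreover have "set bs \<subseteq> V" using bsR roots by auto
    ultimately show False
      using orthogonal_to_span[of "set bs" v a] v a by auto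
  qed
  then obtain us a b vs where dec: "bs = us @ a # b # vs"
    and le: "ip (s b (act vs v)) v \<le> ip (s a (s b (act vs v))) v"
    and less: "ip (s b (act vs v)) v < ip (act vs v) v"
    using valley_in_word[OF bsR v(1) act] by metis
  have ab: "a \<in> \<Phi>" "b \<in> \<Phi>" and vs: "set vs \<subseteq> V" using bsR dec by auto
  define y where "y = act vs v"
  define x where "x = s b y"
  have y: "y \<in> V" using vs v by (auto simp: y_def)
  have x: "x \<in> V" using y ab by (auto simp: x_def)
  have sbx: "s b x = y" using y ab by (simp add: x_def s_involution)
  have left: "ip (s a (s b x)) v \<le> ip x v"
  proof -
    let ?cs = "s a b # a # vs"
    have hl: "same_lattice_word bs (us @ ?cs)" using hurwitz_left bsR unfolding dec by simp
    then have "act (us @ ?cs) v = act bs v" using v by (auto simp: same_lattice_word_def)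
    have eq: "act ?cs v = act (a # b # vs) v"
      using ab y by (simp add: s_conjugate flip: y_def)
    have "height v (us @ ?cs) - height v bs = height v ?cs - height v (a # b # vs)"
      unfolding dec using eq by (rule height_append)
    then show ?thesis using max[OF hl] eq sbx by (simp add: x_def flip: y_def)
  qed
  have right: "ip (s b (s a x)) v \<le> ip x v"
  proof -
    let ?cs = "b # s b a # vs"
    have hr: "same_lattice_word bs (us @ ?cs)" using hurwitz_right bsR unfolding dec by simp
    have conj: "s (s b a) y = s b (s a x)" using s_conjugate[of b a x] ab x sbx by simp
    have eq: "act ?cs v = act (a # b # vs) v"
      using ab x by (simp add: conj s_involution flip: y_def x_def)
    have "height v (us @ ?cs) - height v bs = height v ?cs - height v (a # b # vs)"
      unfolding dec using eq by (rule height_append)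
    then show ?thesis using max[OF hr] eq by (simp add: conj flip: y_def x_def)
  qed
  have "\<not> root_pairing ip a b * root_pairing ip b a < 4"
    using dihedral_ascent[of a b x v] left right ab x v le less sbx
    by (auto simp flip: y_def x_def)
  then obtain c where "a = c *\<^sub>R b"
    using parallel_if_pairing_product[of a b] ab by auto
  then show ?thesis
    using sheds_parallel_neighbours[of us a b vs] bsR bs sheds_pair_cong unfolding dec by blast
qed

lemma sheds_pair_Cons:
  assumes "a \<in> \<Phi>" "sheds_pair as"
  shows "sheds_pair (a # as)"
proof -
  obtain bs \<beta> where b: "length as = length bs + 2" "set bs \<subseteq> \<Phi>" "\<beta> \<in> \<Phi>"
    "\<forall>x\<in>V. act bs x = act as x" "group_closure (set as) = group_closure (insert \<beta> (set bs))"
    using assms(2) unfolding sheds_pair_def by auto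
  have "group_closure (set (a # as)) = group_closure (insert \<beta> (set (a # bs)))"
    using group_closure_Un_cong[OF b(5), of "{a}"] by (simp add: insert_commute)
  then show ?thesis
    unfolding sheds_pair_def using b assms
    by (intro exI[of _ "a # bs"] exI[of _ \<beta>]) auto
qed

text \<open>
  When the tail of the word is independent but the whole word is not, a vector fixed by the
  product can be written down, and the case of a fixed vector applies.
\<close>

lemma dependent_sheds_pair:
  assumes "set as \<subseteq> \<Phi>" "\<not> (distinct as \<and> independent (set as))"
  shows "sheds_pair as"
  using assms
proof (induction as)
  case Nil
  then show ?case by (simp add: independent_empty)
next
  case (Cons a as)
  have aR: "a \<in> \<Phi>" and asR: "set as \<subseteq> \<Phi>" using Cons.prems by auto
  show ?case
  proof (cases "distinct as \<and> independent (set as)")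
    case False
    then show ?thesis using Cons asR aR sheds_pair_Cons by auto
  next
    case True
    have "a \<in> span (set as)"
    proof (rule ccontr)
      assume "a \<notin> span (set as)"
      then show False
        using True Cons.prems independent_insertI[of a "set as"] span_base[of a "set as"] by auto
    qed
    then obtain z where z: "z \<in> V" "act as z - z = a"
      using independent_imp_moved[of as a] True asR roots by blast
    \<comment> \<open>equal norms of \<open>z\<close> and \<open>z + a\<close> make \<open>s a\<close> exchange the two\<close>
    then have az: "act as z = z + a" by (simp add: algebra_simps)
    have pos: "ip a a > 0" using aR ip_pos by auto
    have "ip (act as z) (act as z) = ip z z" using asR roots z by (intro act_isometry) auto
    then have za: "2 * ip z a = - ip a a"
      using z aR ip_sym[of a z] unfolding az by (simp add: ip_simps)
    then have "root_pairing ip (z + a) a = 1"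
      using pos z aR by (simp add: root_pairing_def ip_simps field_simps)
    then have "act (a # as) z = z" by (simp add: az mirror_def)
    moreover have "ip z a \<noteq> 0" using za pos by auto
    ultimately show ?thesis
      using sheds_pair_if_fixed_vector[of "a # as" z a] Cons.prems z by auto
  qed
qed

text \<open>
  A word longer than some word with the same product is dependent, so shedding goes on until the
  minimal length is reached; each step contributes one root \<open>\<beta>\<close>.
\<close>

lemma sheds_pairs:
  assumes "set as \<subseteq> \<Phi>" "length as = l + 2 * k"
    and short: "\<And>bs. set bs \<subseteq> \<Phi> \<Longrightarrow> \<forall>x\<in>V. act bs x = act as x \<Longrightarrow> l \<le> length bs"
    and ex: "set cs \<subseteq> \<Phi>" "\<forall>x\<in>V. act cs x = act as x" "length cs = l"
  shows "\<exists>bs \<beta>s. set bs \<subseteq> \<Phi> \<and> set \<beta>s \<subseteq> \<Phi> \<and> length bs = l \<and> length \<beta>s = k \<and>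
    (\<forall>x\<in>V. act bs x = act as x) \<and> group_closure (set as) = group_closure (set bs \<union> set \<beta>s)"
  using assms
proof (induction k arbitrary: as)
  case 0
  then show ?case by (intro exI[of _ as] exI[of _ "[]"]) auto
next
  case (Suc k)
  have "\<not> (distinct as \<and> independent (set as))"
    using independent_imp_shortest[of as cs] Suc.prems roots by force
  then have "sheds_pair as" using dependent_sheds_pair Suc.prems by auto
  then obtain bs \<beta> where b: "length as = length bs + 2" "set bs \<subseteq> \<Phi>" "\<beta> \<in> \<Phi>"
    "\<forall>x\<in>V. act bs x = act as x" "group_closure (set as) = group_closure (insert \<beta> (set bs))"
    unfolding sheds_pair_def by auto
  have "\<exists>ds \<beta>s. set ds \<subseteq> \<Phi> \<and> set \<beta>s \<subseteq> \<Phi> \<and> length ds = l \<and> length \<beta>s = k \<and>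
    (\<forall>x\<in>V. act ds x = act bs x) \<and> group_closure (set bs) = group_closure (set ds \<union> set \<beta>s)"
    using b Suc.prems by (intro Suc.IH) auto
  then obtain ds \<beta>s where d: "set ds \<subseteq> \<Phi>" "set \<beta>s \<subseteq> \<Phi>" "length ds = l" "length \<beta>s = k"
    "\<forall>x\<in>V. act ds x = act bs x" "group_closure (set bs) = group_closure (set ds \<union> set \<beta>s)"
    by auto
  have "group_closure (set as) = group_closure (set ds \<union> set (\<beta> # \<beta>s))"
    using b(5) group_closure_Un_cong[OF d(6), of "{\<beta>}"] by simp
  then show ?case
    using b d by (intro exI[of _ ds] exI[of _ "\<beta> # \<beta>s"]) auto
qed

lemma act_doubled: "set \<beta>s \<subseteq> \<Phi> \<Longrightarrow> x \<in> V \<Longrightarrow> act (concat (map (\<lambda>b. [b, b]) \<beta>s)) x = x"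
  by (induction \<beta>s) (auto simp: s_involution)

end

section \<open>Presentations of Weyl group elements\<close>

locale root_lattice =
  fixes L :: "'a::real_vector set" and ip :: "'a \<Rightarrow> 'a \<Rightarrow> real" and \<Phi> :: "'a set"
  assumes pn: "pn_root_lattice L ip \<Phi>"
begin

lemma L_def: "L = group_closure \<Phi>"
  using pn unfolding pn_root_lattice_def by simp

lemma roots_in_L: "\<Phi> \<subseteq> L - {0}"
  using pn unfolding pn_root_lattice_def by simp

lemma reflection_eq_mirror: "x \<in> L \<Longrightarrow> reflection L ip a x = mirror ip a x"
  by (simp add: reflection_def mirror_def)

sublocale root_system "span L" ip \<Phi>
proof
  show "scalar_product_on (span L) ip" "finite \<Phi>"
    using pn unfolding pn_root_lattice_def by auto
  show "\<Phi> \<subseteq> span L - {0}" using roots_in_L span_superset[of L] by auto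
  show "root_pairing ip b a \<in> \<int>" if "a \<in> \<Phi>" "b \<in> \<Phi>" for a b
    using that pn unfolding pn_root_lattice_def by auto
  show "mirror ip a b \<in> \<Phi>" if "a \<in> \<Phi>" "b \<in> \<Phi>" for a b
  proof -
    have "reflection L ip a ` \<Phi> = \<Phi>" using that pn unfolding pn_root_lattice_def by auto
    then have "reflection L ip a b \<in> \<Phi>" using that by blast
    moreover have "b \<in> L" using that roots_in_L by auto
    ultimately show ?thesis by (simp add: reflection_eq_mirror)
  qed
qed auto

lemma L_diff: "x \<in> L \<Longrightarrow> y \<in> L \<Longrightarrow> x - y \<in> L"
  by (auto simp: L_def intro: group_closure.diff)

lemma L_add: "x \<in> L \<Longrightarrow> y \<in> L \<Longrightarrow> x + y \<in> L"
  by (auto simp: L_def intro: group_closure_add)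

lemma L_V: "x \<in> L \<Longrightarrow> x \<in> span L"
  by (rule span_base)

lemma pairing_L_Ints:
  assumes "a \<in> \<Phi>" "x \<in> L"
  shows "root_pairing ip x a \<in> \<int>"
proof -
  have "x \<in> group_closure \<Phi>" using assms L_def by simp
  then show ?thesis
  proof induction
    case (base x)
    then show ?case using assms pairing_Ints by (auto simp: root_pairing_def ip_zero)
  next
    case (diff x y)
    then have "x \<in> span L" "y \<in> span L" using L_def L_V by auto
    then show ?case using diff assms by (simp add: pairing_diff)
  qed
qed

lemma s_in_L: 
  assumes "a \<in> \<Phi>" "x \<in> L"
  shows "s a x \<in> L"
proof -
  have "root_pairing ip x a *\<^sub>R a \<in> L"
    using assms roots_in_L pairing_L_Ints group_closure_Ints_scale[of a \<Phi>] unfolding L_def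
    by (auto simp: group_closure.base)
  then show ?thesis using assms L_diff by (simp add: mirror_def)
qed

lemma act_in_L: "set as \<subseteq> \<Phi> \<Longrightarrow> x \<in> L \<Longrightarrow> act as x \<in> L"
  by (induction as) (auto intro: s_in_L)

lemma foldr_compose_eq_act:
  assumes "set as \<subseteq> \<Phi>"
  shows "foldr (compose L) (map (reflection L ip) as) (\<lambda>x\<in>L. x) = restrict (act as) L"
  using assms
proof (induction as)
  case (Cons a as)
  then show ?case
    using act_in_L[of as] by (auto simp: compose_def reflection_eq_mirror fun_eq_iff)
qed (auto simp: fun_eq_iff)

text \<open>
  Elements of the Weyl group are functions on \<open>L\<close>, while the reduction of words compares products on
  the real span.
\<close>

lemma act_cong_span:
  assumes "set as \<subseteq> \<Phi>" "set bs \<subseteq> \<Phi>" "\<And>x. x \<in> L \<Longrightarrow> act as x = act bs x" "x \<in> span L"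
  shows "act as x = act bs x"
proof -
  have V: "set as \<subseteq> span L" "set bs \<subseteq> span L" using assms root(1) by blast+
  have "act cs 0 = 0" if "set cs \<subseteq> span L" for cs
    using act_scale[OF that, of 0 0] by (simp add: span_zero)
  then have "subspace {x \<in> span L. act as x = act bs x}"
    using V by (auto simp: subspace_def act_add act_scale)
  moreover have "L \<subseteq> {x \<in> span L. act as x = act bs x}" using assms(3) L_V by auto
  ultimately have "span L \<subseteq> {x \<in> span L. act as x = act bs x}" by (metis span_minimal)
  then show ?thesis using assms(4) by auto
qed

lemma presentation_iff:
  "presentation L ip \<Phi> w as \<longleftrightarrow> set as \<subseteq> \<Phi> \<and> w = restrict (act as) L"
  unfolding presentation_def using foldr_compose_eq_act by auto

lemma presentation_cong:
  assumes "presentation L ip \<Phi> w as"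
  shows "presentation L ip \<Phi> w bs \<longleftrightarrow> set bs \<subseteq> \<Phi> \<and> (\<forall>x\<in>span L. act bs x = act as x)"
proof
  assume "presentation L ip \<Phi> w bs"
  then have "set bs \<subseteq> \<Phi>" "restrict (act bs) L = restrict (act as) L" "set as \<subseteq> \<Phi>"
    using assms by (auto simp: presentation_iff)
  then show "set bs \<subseteq> \<Phi> \<and> (\<forall>x\<in>span L. act bs x = act as x)"
    using act_cong_span[of bs as] by (metis restrict_apply')
next
  assume "set bs \<subseteq> \<Phi> \<and> (\<forall>x\<in>span L. act bs x = act as x)"
  then show "presentation L ip \<Phi> w bs"
    using assms by (auto simp: presentation_iff fun_eq_iff L_V)
qed

lemma reflection_in_orthogonal_group:
  assumes "a \<in> \<Phi>"
  shows "reflection L ip a \<in> carrier (orthogonal_group L ip)"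
proof -
  let ?r = "reflection L ip a"
  have inv: "?r x \<in> L" "?r (?r x) = x" if "x \<in> L" for x
    using that assms by (auto simp: reflection_eq_mirror s_in_L s_involution L_V)
  then have "bij_betw ?r L L" by (intro bij_betw_byWitness[of _ ?r]) auto
  moreover have "?r \<in> extensional L" by (simp add: reflection_def)
  ultimately have "?r \<in> Bij L" by (simp add: Bij_def)
  moreover have "?r (x + y) = ?r x + ?r y \<and> ip (?r x) (?r y) = ip x y" if "x \<in> L" "y \<in> L" for x y
    using that assms by (simp add: reflection_eq_mirror L_add s_add s_isometry L_V)
  ultimately show ?thesis by (simp add: orthogonal_group_def)
qed

lemma reflection_self_inverse:
  assumes "a \<in> \<Phi>"
  shows "inv\<^bsub>orthogonal_group L ip\<^esub> (reflection L ip a) = reflection L ip a"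
proof -
  let ?r = "reflection L ip a" and ?G = "orthogonal_group L ip"
  have r: "?r \<in> carrier ?G" using assms by (rule reflection_in_orthogonal_group)
  have rB: "?r \<in> carrier (BijGroup L)"
    using r by (simp add: orthogonal_group_def BijGroup_def)
  have one: "\<one>\<^bsub>?G\<^esub> = \<one>\<^bsub>BijGroup L\<^esub>" and mult: "(\<otimes>\<^bsub>?G\<^esub>) = (\<otimes>\<^bsub>BijGroup L\<^esub>)"
    by (auto simp: orthogonal_group_def)
  have rr: "?r \<otimes>\<^bsub>BijGroup L\<^esub> ?r = \<one>\<^bsub>BijGroup L\<^esub>"
    using rB assms
    by (auto simp: BijGroup_def compose_def fun_eq_iff reflection_eq_mirror s_in_L s_involution L_V)
  show ?thesis
    unfolding m_inv_def one mult
  proof (rule the_equality)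
    show "?r \<in> carrier ?G \<and> ?r \<otimes>\<^bsub>BijGroup L\<^esub> ?r = \<one>\<^bsub>BijGroup L\<^esub> \<and> ?r \<otimes>\<^bsub>BijGroup L\<^esub> ?r = \<one>\<^bsub>BijGroup L\<^esub>"
      using r rr by simp
    fix y
    assume y: "y \<in> carrier ?G \<and> ?r \<otimes>\<^bsub>BijGroup L\<^esub> y = \<one>\<^bsub>BijGroup L\<^esub> \<and> y \<otimes>\<^bsub>BijGroup L\<^esub> ?r = \<one>\<^bsub>BijGroup L\<^esub>"
    then have "y \<in> carrier (BijGroup L)" by (simp add: orthogonal_group_def BijGroup_def)
    then show "y = ?r"
      using y rr rB group.r_cancel_one'[OF group_BijGroup] group.inv_equality[OF group_BijGroup]
      by metis
  qed
qed

text \<open>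
  The group generated by the reflections is built with formal inverses; as reflections are their
  own inverses, words in the roots suffice.
\<close>

lemma presentation_exists:
  assumes "w \<in> weyl_group L ip \<Phi>"
  obtains as where "presentation L ip \<Phi> w as"
proof -
  let ?G = "orthogonal_group L ip"
  have single: "presentation L ip \<Phi> (reflection L ip a) [a]" if "a \<in> \<Phi>" for a
    using that by (auto simp: presentation_iff fun_eq_iff reflection_def mirror_def)
  have "w \<in> generate ?G (reflection L ip ` \<Phi>)" using assms by (simp add: weyl_group_def)
  then have "w \<in> Bij L \<and> (\<exists>as. presentation L ip \<Phi> w as)"
  proof induction
    case one
    have one: "\<one>\<^bsub>?G\<^esub> = (\<lambda>x\<in>L. x)" by (simp add: orthogonal_group_def BijGroup_def)
    have "presentation L ip \<Phi> (\<lambda>x\<in>L. x) []" by (simp add: presentation_def)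
    then show ?case unfolding one using id_Bij by blast
  next
    case (incl h)
    then show ?case
      using single reflection_in_orthogonal_group by (fastforce simp: orthogonal_group_def)
  next
    case (inv h)
    then show ?case
      using single reflection_in_orthogonal_group reflection_self_inverse
      by (fastforce simp: orthogonal_group_def)
  next
    case (eng g h)
    then obtain as bs where ab: "presentation L ip \<Phi> g as" "presentation L ip \<Phi> h bs"
      and B: "g \<in> Bij L" "h \<in> Bij L" by auto
    have eq: "g \<otimes>\<^bsub>?G\<^esub> h = compose L g h"
      using B by (simp add: orthogonal_group_def BijGroup_def)
    have "compose L g h = restrict (act (as @ bs)) L"
      using ab act_in_L[of bs] by (auto simp: presentation_iff compose_def fun_eq_iff)
    then have "presentation L ip \<Phi> (compose L g h) (as @ bs)"
      using ab by (auto simp: presentation_iff)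
    then show ?case unfolding eq using B compose_Bij by blast
  qed
  then show ?thesis using that by blast
qed

end

theorem theorem1p5:
  fixes L :: "'a::real_vector set"
    and ip :: "'a \<Rightarrow> 'a \<Rightarrow> real"
    and \<Phi> :: "'a set"
    and w :: "'a \<Rightarrow> 'a"
  assumes "pn_root_lattice L ip \<Phi>"
    and "w \<in> weyl_group L ip \<Phi>"
  shows "k5 L ip \<Phi> w = k4 L ip \<Phi> w"
proof -
  interpret root_lattice L ip \<Phi> by unfold_locales (fact assms(1))
  let ?l = "weyl_length L ip \<Phi> w"
  obtain as0 where as0: "presentation L ip \<Phi> w as0"
    using presentation_exists[OF assms(2)] .
  have "\<exists>k as. presentation L ip \<Phi> w as \<and> length as = k" using as0 by auto
  then have "\<exists>as. presentation L ip \<Phi> w as \<and> length as = ?l"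
    unfolding weyl_length_def by (rule LeastI_ex)
  then obtain cs where cs: "presentation L ip \<Phi> w cs" "length cs = ?l" by blast
  have short: "?l \<le> length as" if "presentation L ip \<Phi> w as" for as
    unfolding weyl_length_def using that by (intro Least_le) auto
  have k2_le: "k2 L \<Phi> (subroot_lattice as) \<le> length \<beta>s"
    if "set \<beta>s \<subseteq> \<Phi>" "L = group_closure (set as \<union> set \<beta>s)" for as \<beta>s
    unfolding k2_def subroot_lattice_def
    using that by (intro Least_le) (auto simp: group_closure_Un)
  have k2_attained: "\<exists>\<beta>s. length \<beta>s = k2 L \<Phi> (subroot_lattice as) \<and> set \<beta>s \<subseteq> \<Phi> \<and>
      L = group_closure (set as \<union> set \<beta>s)" if "set as \<subseteq> \<Phi>" for as
  proof -
    obtain rs where rs: "set rs = \<Phi>" using finite_list finite_roots by blast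
    have "set as \<union> set rs = \<Phi>" using rs that by auto
    then have "L = group_closure (set as) + group_closure (set rs)"
      using group_closure_Un[of "set as" "set rs"] L_def by simp
    then have "\<exists>k \<beta>s. length \<beta>s = k \<and> set \<beta>s \<subseteq> \<Phi> \<and> L = subroot_lattice as + group_closure (set \<beta>s)"
      unfolding subroot_lattice_def using rs by blast
    then have "\<exists>\<beta>s. length \<beta>s = k2 L \<Phi> (subroot_lattice as) \<and> set \<beta>s \<subseteq> \<Phi> \<and>
        L = subroot_lattice as + group_closure (set \<beta>s)"
      unfolding k2_def by (rule LeastI_ex)
    then show ?thesis by (simp add: subroot_lattice_def group_closure_Un)
  qed
  let ?P5 = "\<lambda>k. \<exists>as. presentation L ip \<Phi> w as \<and> length as = ?l + 2 * k \<and> subroot_lattice as = L"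
  let ?P4 = "\<lambda>k. \<exists>as. reduced_presentation L ip \<Phi> w as \<and> k = k2 L \<Phi> (subroot_lattice as)"
  have P4: "?P4 (k4 L ip \<Phi> w)"
  proof -
    have "\<exists>k. ?P4 k" using cs unfolding reduced_presentation_def by blast
    then show ?thesis unfolding k4_def by (rule LeastI_ex)
  qed
  then obtain as where as: "presentation L ip \<Phi> w as" "length as = ?l"
    "k4 L ip \<Phi> w = k2 L \<Phi> (subroot_lattice as)"
    unfolding reduced_presentation_def by blast
  have asR: "set as \<subseteq> \<Phi>" using as by (simp add: presentation_iff)
  obtain \<beta>s where \<beta>s: "length \<beta>s = k4 L ip \<Phi> w" "set \<beta>s \<subseteq> \<Phi>"
    "L = group_closure (set as \<union> set \<beta>s)"
    using k2_attained[OF asR] unfolding as(3)[symmetric] by blast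
  let ?ds = "as @ concat (map (\<lambda>b. [b, b]) \<beta>s)"
  have set_ds: "set ?ds = set as \<union> set \<beta>s" by auto
  have "length (concat (map (\<lambda>b. [b, b]) \<beta>s)) = 2 * length \<beta>s" by (induction \<beta>s) auto
  then have "length ?ds = ?l + 2 * k4 L ip \<Phi> w" using as \<beta>s by simp
  moreover have "presentation L ip \<Phi> w ?ds"
    using presentation_cong[OF as(1), of ?ds] set_ds asR \<beta>s act_doubled by auto
  moreover have "subroot_lattice ?ds = L" unfolding subroot_lattice_def set_ds using \<beta>s by simp
  ultimately have P5: "?P5 (k4 L ip \<Phi> w)" by blast
  then have le: "k5 L ip \<Phi> w \<le> k4 L ip \<Phi> w" unfolding k5_def by (rule Least_le)
  from P5 have "?P5 (k5 L ip \<Phi> w)" unfolding k5_def by (rule LeastI)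
  then obtain es where es: "presentation L ip \<Phi> w es" "length es = ?l + 2 * k5 L ip \<Phi> w"
    "subroot_lattice es = L" by blast
  have esR: "set es \<subseteq> \<Phi>" using es by (simp add: presentation_iff)
  have "\<exists>bs \<beta>s. set bs \<subseteq> \<Phi> \<and> set \<beta>s \<subseteq> \<Phi> \<and> length bs = ?l \<and> length \<beta>s = k5 L ip \<Phi> w \<and>
    (\<forall>x\<in>span L. act bs x = act es x) \<and> group_closure (set es) = group_closure (set bs \<union> set \<beta>s)"
    using presentation_cong[OF es(1)] cs short esR es(2) by (intro sheds_pairs[of _ _ _ cs]) auto
  then obtain bs \<gamma>s where bs: "set bs \<subseteq> \<Phi>" "set \<gamma>s \<subseteq> \<Phi>" "length bs = ?l"
    "length \<gamma>s = k5 L ip \<Phi> w" "\<forall>x\<in>span L. act bs x = act es x"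
    "group_closure (set es) = group_closure (set bs \<union> set \<gamma>s)" by blast
  have "reduced_presentation L ip \<Phi> w bs"
    using bs presentation_cong[OF es(1), of bs] by (simp add: reduced_presentation_def)
  then have "k4 L ip \<Phi> w \<le> k2 L \<Phi> (subroot_lattice bs)"
    unfolding k4_def by (intro Least_le) blast
  also have "\<dots> \<le> length \<gamma>s"
    using bs es(3) by (intro k2_le) (auto simp: subroot_lattice_def)
  finally show ?thesis using le bs(4) by simp
qed

end
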